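(* Let $(A,\mu,\Delta)$ be a dendriform-Nijenhuis bialgebra and let $\mathrm{End}(A)$ be the associative algebra of $k$-linear endomorphisms of $A$ under composition (with unit $id$), equipped also with the convolution product $*$. Define $\beta,\gamma:\mathrm{End}(A)\to\mathrm{End}(A)$ by $\beta(T):=id*T$ (right shift) and $\gamma(T):=T*id$ (left shift). Then $\beta$ is a Nijenhuis operator and $\gamma$ is a $TD$-operator on the algebra $\mathrm{End}(A)$ (under composition). Moreover $\beta\gamma=\gamma\beta$.
   Context: Throughout, $k$ is a field of characteristic zero. A dendriform-Nijenhuis bialgebra is a triple $(A,\mu,\Delta)$ where $(A,\mu)$ is an associative $k$-algebra, $(A,\Delta)$ is a coassociative coalgebra (no counit is required), and $\Delta(ab)=\Delta(a)b+a\Delta(b)-\mu(\Delta(a))\otimes b$ for all $a,b\in A$; here, if $\Delta(a)=a_{(1)}\otimes a_{(2)}$ (Sweedler notation), $\Delta(a)b:=a_{(1)}\otimes a_{(2)}b$ and $a\Delta(b):=ab_{(1)}\otimes b_{(2)}$. The convolution product is $T*S:=\mu(T\otimes S)\Delta$ for $T,S\in\mathrm{End}(A)$. A Nijenhuis operator on an associative algebra $E$ is a linear map $\beta:E\to E$ with $\beta(x)\beta(y)+\beta^2(xy)=\beta(\beta(x)y+x\beta(y))$ for all $x,y$. A $TD$-operator on a unital associative algebra $E$ with unit $i$ is a linear map $\gamma:E\to E$ with $\gamma(x)\gamma(y)=\gamma(\gamma(x)y+x\gamma(y)-x\gamma(i)y)$ for all $x,y$. *)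

theory Defs
  imports Complex_Main "HOL-Library.Poly_Mapping" "HOL-Library.Function_Algebras"
begin

section \<open>Associative algebras and operators on them\<close>

text \<open>
  Algebras live on a linear subspace \<open>E\<close> of an ambient vector space. The carrier is needed because
  \<open>End(A)\<close> is a proper subset of the type of all functions on \<open>A\<close>; the algebra \<open>A\<close> itself
  uses \<open>E = UNIV\<close>. No unit is assumed.
\<close>

locale assoc_algebra = vector_space scale
  for scale :: "'k::field \<Rightarrow> 'v::ab_group_add \<Rightarrow> 'v" +
  fixes E :: "'v set" and mult :: "'v \<Rightarrow> 'v \<Rightarrow> 'v"
  assumes carrier_subspace: "subspace E"
    and mult_closed: "x \<in> E \<Longrightarrow> y \<in> E \<Longrightarrow> mult x y \<in> E"
    and mult_add_left: "x \<in> E \<Longrightarrow> x' \<in> E \<Longrightarrow> y \<in> E \<Longrightarrow> mult (x + x') y = mult x y + mult x' y"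
    and mult_add_right: "x \<in> E \<Longrightarrow> y \<in> E \<Longrightarrow> y' \<in> E \<Longrightarrow> mult x (y + y') = mult x y + mult x y'"
    and mult_scale_left: "x \<in> E \<Longrightarrow> y \<in> E \<Longrightarrow> mult (scale c x) y = scale c (mult x y)"
    and mult_scale_right: "x \<in> E \<Longrightarrow> y \<in> E \<Longrightarrow> mult x (scale c y) = scale c (mult x y)"
    and mult_assoc: "x \<in> E \<Longrightarrow> y \<in> E \<Longrightarrow> z \<in> E \<Longrightarrow> mult (mult x y) z = mult x (mult y z)"

locale unital_assoc_algebra = assoc_algebra scale E mult
  for scale :: "'k::field \<Rightarrow> 'v::ab_group_add \<Rightarrow> 'v" and E mult +
  fixes unit :: 'v
  assumes unit_closed: "unit \<in> E"
    and unit_left: "x \<in> E \<Longrightarrow> mult unit x = x"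
    and unit_right: "x \<in> E \<Longrightarrow> mult x unit = x"

definition linear_endo_on :: "('k::field \<Rightarrow> 'v::ab_group_add \<Rightarrow> 'v) \<Rightarrow> 'v set \<Rightarrow> ('v \<Rightarrow> 'v) \<Rightarrow> bool" where
  "linear_endo_on scale E f \<longleftrightarrow>
     (\<forall>x\<in>E. f x \<in> E) \<and>
     (\<forall>x\<in>E. \<forall>y\<in>E. f (x + y) = f x + f y) \<and>
     (\<forall>c. \<forall>x\<in>E. f (scale c x) = scale c (f x))"

definition nijenhuis_operator ::
  "('k::field \<Rightarrow> 'v::ab_group_add \<Rightarrow> 'v) \<Rightarrow> 'v set \<Rightarrow> ('v \<Rightarrow> 'v \<Rightarrow> 'v) \<Rightarrow> ('v \<Rightarrow> 'v) \<Rightarrow> bool" where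
  "nijenhuis_operator scale E mult \<beta> \<longleftrightarrow>
     assoc_algebra scale E mult \<and> linear_endo_on scale E \<beta> \<and>
     (\<forall>x\<in>E. \<forall>y\<in>E. mult (\<beta> x) (\<beta> y) + \<beta> (\<beta> (mult x y)) = \<beta> (mult (\<beta> x) y + mult x (\<beta> y)))"

definition TD_operator ::
  "('k::field \<Rightarrow> 'v::ab_group_add \<Rightarrow> 'v) \<Rightarrow> 'v set \<Rightarrow> ('v \<Rightarrow> 'v \<Rightarrow> 'v) \<Rightarrow> 'v \<Rightarrow> ('v \<Rightarrow> 'v) \<Rightarrow> bool" where
  "TD_operator scale E mult i \<gamma> \<longleftrightarrow>
     unital_assoc_algebra scale E mult i \<and> linear_endo_on scale E \<gamma> \<and>
     (\<forall>x\<in>E. \<forall>y\<in>E. mult (\<gamma> x) (\<gamma> y) =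
        \<gamma> (mult (\<gamma> x) y + mult x (\<gamma> y) - mult (mult x (\<gamma> i)) y))"


section \<open>Free vector spaces\<close>

text \<open>The free vector space on \<open>'x\<close> is the type \<open>'x \<Rightarrow>\<^sub>0 'k\<close> of formal finite linear combinations.\<close>

definition fscale :: "'k::field \<Rightarrow> ('x \<Rightarrow>\<^sub>0 'k) \<Rightarrow> ('x \<Rightarrow>\<^sub>0 'k)" where
  "fscale c p = Poly_Mapping.map (\<lambda>d. c * d) p"

abbreviation gen :: "'x \<Rightarrow> ('x \<Rightarrow>\<^sub>0 'k::field)" where
  "gen x \<equiv> Poly_Mapping.single x 1"

definition lin_ext :: "('k::field \<Rightarrow> 'v::ab_group_add \<Rightarrow> 'v) \<Rightarrow> ('x \<Rightarrow> 'v) \<Rightarrow> ('x \<Rightarrow>\<^sub>0 'k) \<Rightarrow> 'v" where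
  "lin_ext scale f p = (\<Sum>x\<in>Poly_Mapping.keys p. scale (Poly_Mapping.lookup p x) (f x))"

lemma lookup_fscale: "Poly_Mapping.lookup (fscale c p) x = c * Poly_Mapping.lookup p x"
  by (simp add: fscale_def Poly_Mapping.map.rep_eq when_def)

lemma vector_space_fscale: "vector_space (fscale :: 'k::field \<Rightarrow> ('x \<Rightarrow>\<^sub>0 'k) \<Rightarrow> _)"
  by unfold_locales (auto intro!: poly_mapping_eqI simp: lookup_fscale lookup_add algebra_simps)

interpretation free: vector_space "fscale :: 'k::field \<Rightarrow> ('x \<Rightarrow>\<^sub>0 'k) \<Rightarrow> _"
  by (rule vector_space_fscale)

lemma lin_ext_superset:
  assumes "vector_space scale" "finite S" "Poly_Mapping.keys p \<subseteq> S"
  shows "lin_ext scale f p = (\<Sum>x\<in>S. scale (Poly_Mapping.lookup p x) (f x))"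
proof -
  interpret vector_space scale by fact
  show ?thesis unfolding lin_ext_def
    by (rule sum.mono_neutral_left) (use assms in \<open>auto simp: in_keys_iff\<close>)
qed

lemma linear_lin_ext:
  assumes "vector_space scale"
  shows "Vector_Spaces.linear fscale scale (lin_ext scale f)"
proof -
  interpret vector_space scale by fact
  have add: "lin_ext scale f (p + q) = lin_ext scale f p + lin_ext scale f q" for p q
  proof -
    let ?S = "Poly_Mapping.keys p \<union> Poly_Mapping.keys q"
    have sub: "Poly_Mapping.keys (p + q) \<subseteq> ?S" by (rule Poly_Mapping.keys_add)
    have fin: "finite ?S" by simp
    show ?thesis
      using lin_ext_superset[OF assms fin sub, of f]
        lin_ext_superset[OF assms fin Un_upper1, of f] lin_ext_superset[OF assms fin Un_upper2, of f]
      by (simp add: lookup_add scale_left_distrib sum.distrib)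
  qed
  have sc: "lin_ext scale f (fscale c p) = scale c (lin_ext scale f p)" for c p
  proof -
    have sub: "Poly_Mapping.keys (fscale c p) \<subseteq> Poly_Mapping.keys p"
      by (auto simp: in_keys_iff lookup_fscale)
    show ?thesis
      using lin_ext_superset[OF assms finite_keys sub, of f]
      by (simp add: lookup_fscale lin_ext_def scale_sum_right)
  qed
  show ?thesis
    unfolding Vector_Spaces.linear_iff using assms vector_space_fscale add sc by blast
qed

lemma lin_ext_gen: "vector_space scale \<Longrightarrow> lin_ext scale f (gen x) = f x"
  by (simp add: lin_ext_def vector_space.vector_space_assms(4))


section \<open>Tensor products\<close>

text \<open>
  \<open>A \<otimes> A\<close> and \<open>A \<otimes> A \<otimes> A\<close> are the quotients of the free vector spaces on \<open>A \<times> A\<close> and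
  \<open>A \<times> A \<times> A\<close> by the subspaces spanned by the multilinearity relations. A tensor is a coset,
  that is, a set of formal linear combinations. Operations on tensors are given on a chosen
  representative \<open>rep X\<close>; the lemmas below show that the choice does not matter.
\<close>

definition tensor2_null :: "('k::field \<Rightarrow> 'a::ab_group_add \<Rightarrow> 'a) \<Rightarrow> (('a \<times> 'a) \<Rightarrow>\<^sub>0 'k) set" where
  "tensor2_null scale = module.span fscale
     ({gen (x + x', y) - gen (x, y) - gen (x', y) | x x' y. True} \<union>
      {gen (x, y + y') - gen (x, y) - gen (x, y') | x y y'. True} \<union>
      {gen (scale c x, y) - fscale c (gen (x, y)) | c x y. True} \<union>
      {gen (x, scale c y) - fscale c (gen (x, y)) | c x y. True})"

definition tensor3_null :: "('k::field \<Rightarrow> 'a::ab_group_add \<Rightarrow> 'a) \<Rightarrow> (('a \<times> 'a \<times> 'a) \<Rightarrow>\<^sub>0 'k) set" where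
  "tensor3_null scale = module.span fscale
     ({gen (x + x', y, z) - gen (x, y, z) - gen (x', y, z) | x x' y z. True} \<union>
      {gen (x, y + y', z) - gen (x, y, z) - gen (x, y', z) | x y y' z. True} \<union>
      {gen (x, y, z + z') - gen (x, y, z) - gen (x, y, z') | x y z z'. True} \<union>
      {gen (scale c x, y, z) - fscale c (gen (x, y, z)) | c x y z. True} \<union>
      {gen (x, scale c y, z) - fscale c (gen (x, y, z)) | c x y z. True} \<union>
      {gen (x, y, scale c z) - fscale c (gen (x, y, z)) | c x y z. True})"

definition coset :: "'v::ab_group_add set \<Rightarrow> 'v \<Rightarrow> 'v set" where
  "coset N p = {q. q - p \<in> N}"

definition rep :: "'v set \<Rightarrow> 'v" where
  "rep X = (SOME p. p \<in> X)"

definition tensor2 :: "('k::field \<Rightarrow> 'a::ab_group_add \<Rightarrow> 'a) \<Rightarrow> (('a \<times> 'a) \<Rightarrow>\<^sub>0 'k) \<Rightarrow> (('a \<times> 'a) \<Rightarrow>\<^sub>0 'k) set" where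
  "tensor2 scale p = coset (tensor2_null scale) p"

definition tensor3 :: "('k::field \<Rightarrow> 'a::ab_group_add \<Rightarrow> 'a) \<Rightarrow> (('a \<times> 'a \<times> 'a) \<Rightarrow>\<^sub>0 'k) \<Rightarrow> (('a \<times> 'a \<times> 'a) \<Rightarrow>\<^sub>0 'k) set" where
  "tensor3 scale p = coset (tensor3_null scale) p"

definition tensor2_space :: "('k::field \<Rightarrow> 'a::ab_group_add \<Rightarrow> 'a) \<Rightarrow> (('a \<times> 'a) \<Rightarrow>\<^sub>0 'k) set set" where
  "tensor2_space scale = tensor2 scale ` UNIV"

definition tensor_add where
  "tensor_add scale X Y = tensor2 scale (rep X + rep Y)"

definition tensor_diff where
  "tensor_diff scale X Y = tensor2 scale (rep X - rep Y)"

definition tensor_scale where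
  "tensor_scale scale c X = tensor2 scale (fscale c (rep X))"

definition pure_tensor where
  "pure_tensor scale x y = tensor2 scale (gen (x, y))"

text \<open>The multiplication seen as a linear map \<open>A \<otimes> A \<rightarrow> A\<close>, and \<open>T \<otimes> S\<close> as a map \<open>A \<otimes> A \<rightarrow> A \<otimes> A\<close>.\<close>

definition tensor_mult ::
  "('k::field \<Rightarrow> 'a::ab_group_add \<Rightarrow> 'a) \<Rightarrow> ('a \<Rightarrow> 'a \<Rightarrow> 'a) \<Rightarrow> (('a \<times> 'a) \<Rightarrow>\<^sub>0 'k) set \<Rightarrow> 'a" where
  "tensor_mult scale mult X = lin_ext scale (\<lambda>(x, y). mult x y) (rep X)"

definition tensor_map ::
  "('k::field \<Rightarrow> 'a::ab_group_add \<Rightarrow> 'a) \<Rightarrow> ('a \<Rightarrow> 'a) \<Rightarrow> ('a \<Rightarrow> 'a) \<Rightarrow>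
     (('a \<times> 'a) \<Rightarrow>\<^sub>0 'k) set \<Rightarrow> (('a \<times> 'a) \<Rightarrow>\<^sub>0 'k) set" where
  "tensor_map scale T S X = tensor2 scale (lin_ext fscale (\<lambda>(x, y). gen (T x, S y)) (rep X))"

text \<open>The maps \<open>\<Delta> \<otimes> id\<close> and \<open>id \<otimes> \<Delta>\<close> from \<open>A \<otimes> A\<close> to \<open>A \<otimes> A \<otimes> A\<close>.\<close>

definition comult_id ::
  "('k::field \<Rightarrow> 'a::ab_group_add \<Rightarrow> 'a) \<Rightarrow> ('a \<Rightarrow> (('a \<times> 'a) \<Rightarrow>\<^sub>0 'k) set) \<Rightarrow>
     (('a \<times> 'a) \<Rightarrow>\<^sub>0 'k) set \<Rightarrow> (('a \<times> 'a \<times> 'a) \<Rightarrow>\<^sub>0 'k) set" where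
  "comult_id scale \<Delta> X = tensor3 scale
     (lin_ext fscale (\<lambda>(x, y). lin_ext fscale (\<lambda>(u, v). gen (u, v, y)) (rep (\<Delta> x))) (rep X))"

definition id_comult ::
  "('k::field \<Rightarrow> 'a::ab_group_add \<Rightarrow> 'a) \<Rightarrow> ('a \<Rightarrow> (('a \<times> 'a) \<Rightarrow>\<^sub>0 'k) set) \<Rightarrow>
     (('a \<times> 'a) \<Rightarrow>\<^sub>0 'k) set \<Rightarrow> (('a \<times> 'a \<times> 'a) \<Rightarrow>\<^sub>0 'k) set" where
  "id_comult scale \<Delta> X = tensor3 scale
     (lin_ext fscale (\<lambda>(x, y). lin_ext fscale (\<lambda>(u, v). gen (x, u, v)) (rep (\<Delta> y))) (rep X))"


section \<open>Dendriform-Nijenhuis bialgebras\<close>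

locale coassoc_coalgebra = vector_space scale
  for scale :: "'k::field \<Rightarrow> 'a::ab_group_add \<Rightarrow> 'a" +
  fixes \<Delta> :: "'a \<Rightarrow> (('a \<times> 'a) \<Rightarrow>\<^sub>0 'k) set"
  assumes comult_closed: "\<Delta> a \<in> tensor2_space scale"
    and comult_add: "\<Delta> (a + b) = tensor_add scale (\<Delta> a) (\<Delta> b)"
    and comult_scale: "\<Delta> (scale c a) = tensor_scale scale c (\<Delta> a)"
    and coassoc: "comult_id scale \<Delta> (\<Delta> a) = id_comult scale \<Delta> (\<Delta> a)"

text \<open>
  In the compatibility condition \<open>\<Delta>(a)b\<close> is \<open>(id \<otimes> (\<cdot> b))(\<Delta>(a))\<close> and \<open>a\<Delta>(b)\<close> is
  \<open>((a \<cdot>) \<otimes> id)(\<Delta>(b))\<close>.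
\<close>

locale dendriform_nijenhuis_bialgebra =
  assoc_algebra scale UNIV \<mu> + coassoc_coalgebra scale \<Delta>
  for scale :: "'k::field_char_0 \<Rightarrow> 'a::ab_group_add \<Rightarrow> 'a"
    and \<mu> :: "'a \<Rightarrow> 'a \<Rightarrow> 'a"
    and \<Delta> :: "'a \<Rightarrow> (('a \<times> 'a) \<Rightarrow>\<^sub>0 'k) set" +
  assumes compat: "\<Delta> (\<mu> a b) =
    tensor_diff scale
      (tensor_add scale
        (tensor_map scale id (\<lambda>y. \<mu> y b) (\<Delta> a))
        (tensor_map scale (\<lambda>x. \<mu> a x) id (\<Delta> b)))
      (pure_tensor scale (tensor_mult scale \<mu> (\<Delta> a)) b)"

text \<open>Addition and subtraction in \<open>End(A)\<close> are the pointwise ones from \<open>Function_Algebras\<close>.\<close>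

definition End :: "('k::field \<Rightarrow> 'a::ab_group_add \<Rightarrow> 'a) \<Rightarrow> ('a \<Rightarrow> 'a) set" where
  "End scale = {T. Vector_Spaces.linear scale scale T}"

definition end_scale :: "('k::field \<Rightarrow> 'a::ab_group_add \<Rightarrow> 'a) \<Rightarrow> 'k \<Rightarrow> ('a \<Rightarrow> 'a) \<Rightarrow> ('a \<Rightarrow> 'a)" where
  "end_scale scale c T = (\<lambda>a. scale c (T a))"

definition convolution ::
  "('k::field \<Rightarrow> 'a::ab_group_add \<Rightarrow> 'a) \<Rightarrow> ('a \<Rightarrow> 'a \<Rightarrow> 'a) \<Rightarrow> ('a \<Rightarrow> (('a \<times> 'a) \<Rightarrow>\<^sub>0 'k) set) \<Rightarrow>
     ('a \<Rightarrow> 'a) \<Rightarrow> ('a \<Rightarrow> 'a) \<Rightarrow> ('a \<Rightarrow> 'a)" where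
  "convolution scale \<mu> \<Delta> T S = (\<lambda>a. tensor_mult scale \<mu> (tensor_map scale T S (\<Delta> a)))"

definition right_shift where
  "right_shift scale \<mu> \<Delta> T = convolution scale \<mu> \<Delta> id T"

definition left_shift where
  "left_shift scale \<mu> \<Delta> T = convolution scale \<mu> \<Delta> T id"


section \<open>Independence of representatives\<close>

lemma rep_coset:
  assumes "free.subspace N"
  shows "rep (coset N p) - p \<in> N"
proof -
  have "p \<in> coset N p" using assms by (simp add: coset_def free.subspace_0)
  then have "rep (coset N p) \<in> coset N p" unfolding rep_def by (rule someI)
  then show ?thesis by (simp add: coset_def)
qed

lemma coset_eq_iff:
  assumes "free.subspace N"
  shows "coset N p = coset N q \<longleftrightarrow> p - q \<in> N"
proof
  assume eq: "coset N p = coset N q"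
  have "p \<in> coset N p" using assms by (simp add: coset_def free.subspace_0)
  with eq show "p - q \<in> N" by (auto simp: coset_def)
next
  assume pq: "p - q \<in> N"
  have "r - p \<in> N \<longleftrightarrow> r - q \<in> N" for r
    using free.subspace_add[OF assms pq, of "r - p"] free.subspace_diff[OF assms _ pq, of "r - q"]
    by (auto simp: algebra_simps)
  then show "coset N p = coset N q" by (simp add: coset_def)
qed

lemma subspace_tensor2_null: "free.subspace (tensor2_null scale)"
  by (simp add: tensor2_null_def free.subspace_span)

lemma subspace_tensor3_null: "free.subspace (tensor3_null scale)"
  by (simp add: tensor3_null_def free.subspace_span)

lemma tensor2_eq_iff: "tensor2 scale p = tensor2 scale q \<longleftrightarrow> p - q \<in> tensor2_null scale"
  by (simp add: tensor2_def coset_eq_iff subspace_tensor2_null)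

lemma tensor3_eq_iff: "tensor3 scale p = tensor3 scale q \<longleftrightarrow> p - q \<in> tensor3_null scale"
  by (simp add: tensor3_def coset_eq_iff subspace_tensor3_null)

lemma rep_tensor2: "rep (tensor2 scale p) - p \<in> tensor2_null scale"
  by (simp add: tensor2_def rep_coset subspace_tensor2_null)

lemma tensor_add_tensor2:
  "tensor_add scale (tensor2 scale p) (tensor2 scale q) = tensor2 scale (p + q)"
  unfolding tensor_add_def tensor2_eq_iff
  using free.subspace_add[OF subspace_tensor2_null rep_tensor2[of scale p] rep_tensor2[of scale q]]
  by (simp add: algebra_simps)

lemma tensor_diff_tensor2:
  "tensor_diff scale (tensor2 scale p) (tensor2 scale q) = tensor2 scale (p - q)"
  unfolding tensor_diff_def tensor2_eq_iff
  using free.subspace_diff[OF subspace_tensor2_null rep_tensor2[of scale p] rep_tensor2[of scale q]]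
  by (simp add: algebra_simps)

lemma tensor_scale_tensor2:
  "tensor_scale scale c (tensor2 scale p) = tensor2 scale (fscale c p)"
  unfolding tensor_scale_def tensor2_eq_iff
  using free.subspace_scale[OF subspace_tensor2_null rep_tensor2[of scale p], of c]
  by (simp add: free.scale_right_diff_distrib)

lemma tensor2_null_gens:
  "gen (x + x', y) - gen (x, y) - gen (x', y) \<in> tensor2_null scale"
  "gen (x, y + y') - gen (x, y) - gen (x, y') \<in> tensor2_null scale"
  "gen (scale c x, y) - fscale c (gen (x, y)) \<in> tensor2_null scale"
  "gen (x, scale c y) - fscale c (gen (x, y)) \<in> tensor2_null scale"
  unfolding tensor2_null_def by - (rule free.span_base, blast)+

lemma tensor3_null_gens:
  "gen (x + x', y, z) - gen (x, y, z) - gen (x', y, z) \<in> tensor3_null scale"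
  "gen (x, y + y', z) - gen (x, y, z) - gen (x, y', z) \<in> tensor3_null scale"
  "gen (x, y, z + z') - gen (x, y, z) - gen (x, y, z') \<in> tensor3_null scale"
  "gen (scale c x, y, z) - fscale c (gen (x, y, z)) \<in> tensor3_null scale"
  "gen (x, scale c y, z) - fscale c (gen (x, y, z)) \<in> tensor3_null scale"
  "gen (x, y, scale c z) - fscale c (gen (x, y, z)) \<in> tensor3_null scale"
  unfolding tensor3_null_def by - (rule free.span_base, fast)+

text \<open>A map that is bilinear modulo a subspace \<open>M\<close> sends the null space of the tensor product into \<open>M\<close>.\<close>

lemma lin_ext_tensor2_null:
  assumes vs: "vector_space s" and M: "module.subspace s M"
    and add_left: "\<And>x x' y. f (x + x', y) - f (x, y) - f (x', y) \<in> M"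
    and add_right: "\<And>x y y'. f (x, y + y') - f (x, y) - f (x, y') \<in> M"
    and scale_left: "\<And>c x y. f (scale c x, y) - s c (f (x, y)) \<in> M"
    and scale_right: "\<And>c x y. f (x, scale c y) - s c (f (x, y)) \<in> M"
    and p: "p \<in> tensor2_null scale"
  shows "lin_ext s f p \<in> M"
proof -
  interpret L: Vector_Spaces.linear fscale s "lin_ext s f" by (rule linear_lin_ext[OF vs])
  have "free.subspace {p. lin_ext s f p \<in> M}"
    by (rule L.subspace_linear_preimage[OF M])
  from free.span_minimal[OF _ this]
  have "tensor2_null scale \<subseteq> {p. lin_ext s f p \<in> M}"
    unfolding tensor2_null_def
    by (rule meta_mp)
      (auto simp: L.diff L.scale lin_ext_gen[OF vs] add_left add_right scale_left scale_right)
  with p show ?thesis by blast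
qed

lemma tensor_mult_tensor2:
  assumes "assoc_algebra scale UNIV mult"
  shows "tensor_mult scale mult (tensor2 scale p) = lin_ext scale (\<lambda>(x, y). mult x y) p"
proof -
  interpret assoc_algebra scale UNIV mult by fact
  have vs: "vector_space scale" by unfold_locales
  interpret L: Vector_Spaces.linear fscale scale "lin_ext scale (\<lambda>(x, y). mult x y)"
    by (rule linear_lin_ext[OF vs])
  have "lin_ext scale (\<lambda>(x, y). mult x y) (rep (tensor2 scale p) - p) \<in> {0}"
    by (rule lin_ext_tensor2_null[OF vs _ _ _ _ _ rep_tensor2])
      (simp_all add: mult_add_left mult_add_right mult_scale_left mult_scale_right)
  then show ?thesis by (simp add: tensor_mult_def L.diff)
qed

lemma tensor_map_tensor2:
  assumes "T \<in> End scale" "S \<in> End scale"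
  shows "tensor_map scale T S (tensor2 scale p) =
    tensor2 scale (lin_ext fscale (\<lambda>(x, y). gen (T x, S y)) p)"
proof -
  interpret T: Vector_Spaces.linear scale scale T using assms by (simp add: End_def)
  interpret S: Vector_Spaces.linear scale scale S using assms by (simp add: End_def)
  let ?f = "\<lambda>(x, y). gen (T x, S y)"
  interpret L: Vector_Spaces.linear fscale fscale "lin_ext fscale ?f"
    by (rule linear_lin_ext[OF vector_space_fscale])
  have "lin_ext fscale ?f (rep (tensor2 scale p) - p) \<in> tensor2_null scale"
    by (rule lin_ext_tensor2_null[OF vector_space_fscale subspace_tensor2_null _ _ _ _ rep_tensor2])
      (simp_all add: T.add S.add T.scale S.scale tensor2_null_gens)
  then show ?thesis by (simp add: tensor_map_def tensor2_eq_iff L.diff)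
qed

lemma lin_ext_mem:
  assumes "vector_space s" "module.subspace s M" "\<And>x. f x \<in> M"
  shows "lin_ext s f p \<in> M"
proof -
  interpret vector_space s by fact
  show ?thesis unfolding lin_ext_def
    by (intro subspace_sum subspace_scale assms)
qed

lemma lin_ext_fun_diff_scale:
  assumes "vector_space s"
  shows "lin_ext s (\<lambda>x. f x - g x) p = lin_ext s f p - lin_ext s g p"
    and "lin_ext s (\<lambda>x. s c (f x)) p = s c (lin_ext s f p)"
proof -
  interpret vector_space s by fact
  show "lin_ext s (\<lambda>x. f x - g x) p = lin_ext s f p - lin_ext s g p"
    by (simp add: lin_ext_def sum_subtractf scale_right_diff_distrib)
  show "lin_ext s (\<lambda>x. s c (f x)) p = s c (lin_ext s f p)"
    by (simp add: lin_ext_def scale_sum_right mult.commute)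
qed

text \<open>
  Any representatives \<open>r x\<close> of the coproducts \<open>\<Delta> x\<close> and any representative of the argument
  compute \<open>\<Delta> \<otimes> id\<close> and \<open>id \<otimes> \<Delta>\<close>.
\<close>

lemma comult_tensor2:
  assumes "coassoc_coalgebra scale \<Delta>" and r: "\<And>x. \<Delta> x = tensor2 scale (r x)"
  shows "comult_id scale \<Delta> (tensor2 scale p) = tensor3 scale
      (lin_ext fscale (\<lambda>(x, y). lin_ext fscale (\<lambda>(u, v). gen (u, v, y)) (r x)) p)"
    and "id_comult scale \<Delta> (tensor2 scale p) = tensor3 scale
      (lin_ext fscale (\<lambda>(x, y). lin_ext fscale (\<lambda>(u, v). gen (x, u, v)) (r y)) p)"
proof -
  interpret coassoc_coalgebra scale \<Delta> by fact
  note fs = vector_space_fscale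
  note sub = subspace_tensor3_null[of scale]
  have r_add: "r (x + y) - r x - r y \<in> tensor2_null scale" for x y
    using comult_add[of x y] by (simp add: r tensor_add_tensor2 tensor2_eq_iff diff_diff_eq)
  have r_scale: "r (scale c x) - fscale c (r x) \<in> tensor2_null scale" for c x
    using comult_scale[of c x] by (simp add: r tensor_scale_tensor2 tensor2_eq_iff)
  have r_rep: "rep (\<Delta> x) - r x \<in> tensor2_null scale" for x
    by (simp add: r rep_tensor2)
  define f where "f y = lin_ext fscale (\<lambda>(u, v). gen (u :: 'b, v :: 'b, y :: 'b) :: _ \<Rightarrow>\<^sub>0 'a)" for y
  define g where "g x = lin_ext fscale (\<lambda>(u, v). gen (x :: 'b, u :: 'b, v :: 'b) :: _ \<Rightarrow>\<^sub>0 'a)" for x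
  have f: "f y q \<in> tensor3_null scale" if "q \<in> tensor2_null scale" for y q
    unfolding f_def using that
    by (intro lin_ext_tensor2_null[OF fs sub]) (simp_all add: tensor3_null_gens)
  have g: "g x q \<in> tensor3_null scale" if "q \<in> tensor2_null scale" for x q
    unfolding g_def using that
    by (intro lin_ext_tensor2_null[OF fs sub]) (simp_all add: tensor3_null_gens)
  interpret F: Vector_Spaces.linear fscale fscale "f y" for y
    unfolding f_def by (rule linear_lin_ext[OF fs])
  interpret G: Vector_Spaces.linear fscale fscale "g x" for x
    unfolding g_def by (rule linear_lin_ext[OF fs])
  have f_add: "f (y + y') q - f y q - f y' q \<in> tensor3_null scale" for y y' q
    unfolding f_def lin_ext_fun_diff_scale[OF fs, symmetric]
    by (rule lin_ext_mem[OF fs sub]) (auto simp: tensor3_null_gens)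
  have g_add: "g (y + y') q - g y q - g y' q \<in> tensor3_null scale" for y y' q
    unfolding g_def lin_ext_fun_diff_scale[OF fs, symmetric]
    by (rule lin_ext_mem[OF fs sub]) (auto simp: tensor3_null_gens)
  have f_scale: "f (scale c y) q - fscale c (f y q) \<in> tensor3_null scale" for c y q
    unfolding f_def lin_ext_fun_diff_scale[OF fs, symmetric]
    by (rule lin_ext_mem[OF fs sub]) (auto simp: tensor3_null_gens)
  have g_scale: "g (scale c y) q - fscale c (g y q) \<in> tensor3_null scale" for c y q
    unfolding g_def lin_ext_fun_diff_scale[OF fs, symmetric]
    by (rule lin_ext_mem[OF fs sub]) (auto simp: tensor3_null_gens)
  have f_r: "f y (r (x + x')) - f y (r x) - f y (r x') \<in> tensor3_null scale"
    "f y (r (scale c x)) - fscale c (f y (r x)) \<in> tensor3_null scale" for x x' y c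
    using f[OF r_add] f[OF r_scale] by (simp_all add: F.diff F.scale)
  have g_r: "g y (r (x + x')) - g y (r x) - g y (r x') \<in> tensor3_null scale"
    "g y (r (scale c x)) - fscale c (g y (r x)) \<in> tensor3_null scale" for x x' y c
    using g[OF r_add] g[OF r_scale] by (simp_all add: G.diff G.scale)
  let ?p = "rep (tensor2 scale p)"
  let ?Fr = "lin_ext fscale (\<lambda>(x, y). f y (r x))" and ?FR = "lin_ext fscale (\<lambda>(x, y). f y (rep (\<Delta> x)))"
  let ?Gr = "lin_ext fscale (\<lambda>(x, y). g x (r y))" and ?GR = "lin_ext fscale (\<lambda>(x, y). g x (rep (\<Delta> y)))"
  interpret FF: Vector_Spaces.linear fscale fscale ?Fr by (rule linear_lin_ext[OF fs])
  interpret GG: Vector_Spaces.linear fscale fscale ?Gr by (rule linear_lin_ext[OF fs])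
  have "?FR ?p - ?Fr ?p \<in> tensor3_null scale"
    unfolding lin_ext_fun_diff_scale[OF fs, symmetric]
    by (rule lin_ext_mem[OF fs sub]) (auto simp: F.diff[symmetric] f r_rep)
  moreover have "?Fr (?p - p) \<in> tensor3_null scale"
    by (rule lin_ext_tensor2_null[OF fs sub _ _ _ _ rep_tensor2])
      (simp_all add: f_add f_scale f_r)
  ultimately have "(?FR ?p - ?Fr ?p) + (?Fr ?p - ?Fr p) \<in> tensor3_null scale"
    unfolding FF.diff by (rule free.subspace_add[OF sub])
  then show "comult_id scale \<Delta> (tensor2 scale p) = tensor3 scale
      (lin_ext fscale (\<lambda>(x, y). lin_ext fscale (\<lambda>(u, v). gen (u, v, y)) (r x)) p)"
    by (simp add: comult_id_def tensor3_eq_iff f_def)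
  have "?GR ?p - ?Gr ?p \<in> tensor3_null scale"
    unfolding lin_ext_fun_diff_scale[OF fs, symmetric]
    by (rule lin_ext_mem[OF fs sub]) (auto simp: G.diff[symmetric] g r_rep)
  moreover have "?Gr (?p - p) \<in> tensor3_null scale"
    by (rule lin_ext_tensor2_null[OF fs sub _ _ _ _ rep_tensor2])
      (simp_all add: g_add g_scale g_r)
  ultimately have "(?GR ?p - ?Gr ?p) + (?Gr ?p - ?Gr p) \<in> tensor3_null scale"
    unfolding GG.diff by (rule free.subspace_add[OF sub])
  then show "id_comult scale \<Delta> (tensor2 scale p) = tensor3 scale
      (lin_ext fscale (\<lambda>(x, y). lin_ext fscale (\<lambda>(u, v). gen (x, u, v)) (r y)) p)"
    by (simp add: id_comult_def tensor3_eq_iff g_def)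
qed

end

theory Submission
  imports Defs
begin

text \<open>
  All identities are contractions of iterated coproducts with multilinear maps. The compatibility
  condition expands \<open>\<Delta>(a\<^sub>1 S(a\<^sub>2))\<close> (resp. \<open>\<Delta>(S(a\<^sub>1) a\<^sub>2)\<close>) into three terms, and coassociativity
  turns them into the three terms of the Nijenhuis (resp. \<open>TD\<close>) identity. The shifts commute because
  both composites send \<open>T\<close> to \<open>a \<mapsto> a\<^sub>1 T(a\<^sub>2) a\<^sub>3\<close>.
\<close>

section \<open>Linear extensions\<close>

lemma linear_image_lin_ext:
  assumes "Vector_Spaces.linear s s' h"
  shows "h (lin_ext s f p) = lin_ext s' (\<lambda>x. h (f x)) p"
proof -
  interpret Vector_Spaces.linear s s' h by fact
  show ?thesis by (simp add: lin_ext_def sum scale)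
qed

lemma lin_ext_lin_ext:
  assumes "vector_space s"
  shows "lin_ext s f (lin_ext fscale g p) = lin_ext s (\<lambda>x. lin_ext s f (g x)) p"
  by (rule linear_image_lin_ext[OF linear_lin_ext[OF assms]])

text \<open>The kernel of the linear extension is a subspace, so it contains the whole span as soon
  as a trilinear \<open>f\<close> kills each relation. This is what lets an equality of cosets in
  \<open>A \<otimes> A \<otimes> A\<close> be evaluated.\<close>

lemma lin_ext_tensor3_null:
  assumes vs: "vector_space s"
    and "\<And>x x' y z. f (x + x', y, z) = f (x, y, z) + f (x', y, z)"
    and "\<And>x y y' z. f (x, y + y', z) = f (x, y, z) + f (x, y', z)"
    and "\<And>x y z z'. f (x, y, z + z') = f (x, y, z) + f (x, y, z')"
    and "\<And>c x y z. f (scale c x, y, z) = s c (f (x, y, z))"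
    and "\<And>c x y z. f (x, scale c y, z) = s c (f (x, y, z))"
    and "\<And>c x y z. f (x, y, scale c z) = s c (f (x, y, z))"
    and p: "p \<in> tensor3_null scale"
  shows "lin_ext s f p = 0"
proof -
  interpret L: Vector_Spaces.linear fscale s "lin_ext s f" by (rule linear_lin_ext[OF vs])
  from free.span_minimal[OF _ L.subspace_kernel]
  have "tensor3_null scale \<subseteq> {p. lin_ext s f p = 0}"
    unfolding tensor3_null_def
    by (rule meta_mp) (auto simp: L.diff L.scale lin_ext_gen[OF vs] assms)
  with p show ?thesis by blast
qed

section \<open>The algebra of endomorphisms\<close>

context vector_space
begin

lemma End_iff:
  "T \<in> End scale \<longleftrightarrow> (\<forall>x y. T (x + y) = T x + T y) \<and> (\<forall>c x. T (scale c x) = scale c (T x))"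
  unfolding End_def Vector_Spaces.linear_iff using vector_space_axioms by blast

lemma vector_space_end_scale: "vector_space (end_scale scale)"
  by unfold_locales (auto simp: end_scale_def fun_eq_iff algebra_simps)

text \<open>Linearity of a composite in its right factor comes from the linearity of the left
  factor; linearity in the left factor is pointwise.\<close>

lemma unital_assoc_algebra_End: "unital_assoc_algebra (end_scale scale) (End scale) (\<circ>) id"
proof -
  interpret E: vector_space "end_scale scale" by (rule vector_space_end_scale)
  show ?thesis
    by unfold_locales
      (auto simp: E.subspace_def End_iff end_scale_def fun_eq_iff algebra_simps)
qed

end

section \<open>Sweedler sums\<close>

context dendriform_nijenhuis_bialgebra
begin

text \<open>The sum \<open>f(a\<^sub>1, a\<^sub>2)\<close>; it is independent of the representative only for bilinear \<open>f\<close>.\<close>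

definition sweedler :: "('a \<Rightarrow> 'a \<Rightarrow> 'a) \<Rightarrow> 'a \<Rightarrow> 'a" where
  "sweedler f a = lin_ext scale (\<lambda>(x, y). f x y) (rep (\<Delta> a))"

definition bilinear_map :: "('a \<Rightarrow> 'a \<Rightarrow> 'a) \<Rightarrow> bool" where
  "bilinear_map f \<longleftrightarrow> (\<forall>x. f x \<in> End scale) \<and> (\<forall>y. (\<lambda>x. f x y) \<in> End scale)"

definition trilinear_map :: "('a \<Rightarrow> 'a \<Rightarrow> 'a \<Rightarrow> 'a) \<Rightarrow> bool" where
  "trilinear_map f \<longleftrightarrow> (\<forall>x. bilinear_map (f x)) \<and> (\<forall>y z. (\<lambda>x. f x y z) \<in> End scale)"

lemmas mult_simps =
  mult_add_left[simplified] mult_add_right[simplified]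
  mult_scale_left[simplified] mult_scale_right[simplified]

lemma comult_eq_rep: "\<Delta> a = tensor2 scale (rep (\<Delta> a))"
proof -
  from comult_closed obtain p where p: "\<Delta> a = tensor2 scale p"
    by (auto simp: tensor2_space_def)
  show ?thesis
    using rep_tensor2[of scale p] free.subspace_neg[OF subspace_tensor2_null, of "rep (\<Delta> a) - p"]
    by (simp add: p tensor2_eq_iff)
qed

text \<open>Two representatives of \<open>\<Delta> a\<close> differ by an element of the null space,
  which a bilinear map sends into \<open>{0}\<close>. Later proofs can thus pick whichever
  representative is convenient.\<close>

lemma sweedler_eq:
  assumes f: "bilinear_map f" and p: "\<Delta> a = tensor2 scale p"
  shows "sweedler f a = lin_ext scale (\<lambda>(x, y). f x y) p"
proof -
  interpret L: Vector_Spaces.linear fscale scale "lin_ext scale (\<lambda>(x, y). f x y)"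
    by (rule linear_lin_ext) (rule vector_space_axioms)
  have "lin_ext scale (\<lambda>(x, y). f x y) (rep (\<Delta> a) - p) \<in> {0}"
    unfolding p
    by (rule lin_ext_tensor2_null[OF vector_space_axioms _ _ _ _ _ rep_tensor2])
      (use f in \<open>simp_all add: bilinear_map_def End_iff\<close>)
  then show ?thesis by (simp add: sweedler_def L.diff)
qed

lemma sweedler_in_End:
  assumes "bilinear_map f"
  shows "sweedler f \<in> End scale"
proof -
  interpret L: Vector_Spaces.linear fscale scale "lin_ext scale (\<lambda>(x, y). f x y)"
    by (rule linear_lin_ext) (rule vector_space_axioms)
  have "sweedler f (a + b) = sweedler f a + sweedler f b" for a b
    \<comment> \<open>Unfolding \<open>tensor_add_def\<close> exhibits
      \<open>rep (\<Delta> a) + rep (\<Delta> b)\<close> as a representative of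
      \<open>\<Delta> (a + b)\<close>.\<close>
    using sweedler_eq[OF assms comult_add[unfolded tensor_add_def]]
    by (simp add: L.add sweedler_def)
  moreover have "sweedler f (scale c a) = scale c (sweedler f a)" for c a
    using sweedler_eq[OF assms comult_scale[unfolded tensor_scale_def]]
    by (simp add: L.scale sweedler_def)
  ultimately show ?thesis by (simp add: End_iff)
qed

lemma linear_image_sweedler:
  assumes "h \<in> End scale"
  shows "h (sweedler f a) = sweedler (\<lambda>x y. h (f x y)) a"
  using assms unfolding sweedler_def End_def
  by (simp add: linear_image_lin_ext case_prod_unfold)

text \<open>No bilinearity is assumed: both sides sum over the same chosen representative.\<close>

lemma sweedler_arith:
  "sweedler (\<lambda>x y. f x y + g x y) a = sweedler f a + sweedler g a"
  "sweedler (\<lambda>x y. f x y - g x y) a = sweedler f a - sweedler g a"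
  "sweedler (\<lambda>x y. scale c (f x y)) a = scale c (sweedler f a)"
  by (simp_all add: sweedler_def lin_ext_def case_prod_unfold algebra_simps sum.distrib
      sum_subtractf scale_sum_right)

text \<open>Both sides evaluate the linear extension of \<open>f\<close> on representatives of
  \<open>(\<Delta> \<otimes> id)\<Delta>(a)\<close> and
  \<open>(id \<otimes> \<Delta>)\<Delta>(a)\<close>. By coassociativity these differ by a null
  element, which a trilinear \<open>f\<close> kills.\<close>

lemma sweedler_coassoc:
  assumes f: "trilinear_map f"
  shows "sweedler (\<lambda>x y. sweedler (\<lambda>u v. f u v y) x) a = sweedler (\<lambda>x y. sweedler (f x) y) a"
proof -
  note vs = vector_space_axioms
  let ?F = "lin_ext scale (\<lambda>(u, v, w). f u v w)"
  interpret L: Vector_Spaces.linear fscale scale ?F by (rule linear_lin_ext[OF vs])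
  let ?l = "lin_ext fscale (\<lambda>(x, y). lin_ext fscale (\<lambda>(u, v). gen (u, v, y)) (rep (\<Delta> x))) (rep (\<Delta> a))"
  let ?r = "lin_ext fscale (\<lambda>(x, y). lin_ext fscale (\<lambda>(u, v). gen (x, u, v)) (rep (\<Delta> y))) (rep (\<Delta> a))"
  have "?l - ?r \<in> tensor3_null scale"
    using coassoc[of a] by (simp add: comult_id_def id_comult_def tensor3_eq_iff)
  then have "?F (?l - ?r) = 0"
    by (rule lin_ext_tensor3_null[OF vs, rotated -1])
      (use f in \<open>simp_all add: trilinear_map_def bilinear_map_def End_iff\<close>)
  then have "?F ?l = ?F ?r" by (simp add: L.diff)
  then show ?thesis
    by (simp add: lin_ext_lin_ext[OF vs] lin_ext_gen[OF vs] sweedler_def case_prod_unfold)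
qed

text \<open>The compatibility condition contracted with \<open>f\<close>: its right side is the
  class of an explicit combination, on which \<open>f\<close> may be evaluated.\<close>

lemma sweedler_mult:
  assumes f: "bilinear_map f"
  shows "sweedler f (\<mu> a b) =
    sweedler (\<lambda>x y. f x (\<mu> y b)) a + sweedler (\<lambda>x y. f (\<mu> a x) y) b - f (sweedler \<mu> a) b"
proof -
  note vs = vector_space_axioms
  let ?F = "lin_ext scale (\<lambda>(x, y). f x y)"
  interpret L: Vector_Spaces.linear fscale scale ?F by (rule linear_lin_ext[OF vs])
  let ?p = "lin_ext fscale (\<lambda>(x, y). gen (x, \<mu> y b)) (rep (\<Delta> a))"
  let ?q = "lin_ext fscale (\<lambda>(x, y). gen (\<mu> a x, y)) (rep (\<Delta> b))"
  have "\<Delta> (\<mu> a b) = tensor2 scale (?p + ?q - gen (sweedler \<mu> a, b))"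
    unfolding compat
    by (simp add: tensor_map_def pure_tensor_def tensor_mult_def sweedler_def
        tensor_add_tensor2 tensor_diff_tensor2)
  from sweedler_eq[OF f this]
  have "sweedler f (\<mu> a b) = ?F ?p + ?F ?q - f (sweedler \<mu> a) b"
    by (simp add: L.add L.diff lin_ext_gen[OF vs])
  then show ?thesis
    by (simp add: lin_ext_lin_ext[OF vs] lin_ext_gen[OF vs] sweedler_def case_prod_unfold)
qed

lemma convolution_eq:
  assumes "T \<in> End scale" "S \<in> End scale"
  shows "convolution scale \<mu> \<Delta> T S a = sweedler (\<lambda>x y. \<mu> (T x) (S y)) a"
proof -
  note vs = vector_space_axioms
  have "convolution scale \<mu> \<Delta> T S a =
    tensor_mult scale \<mu> (tensor2 scale (lin_ext fscale (\<lambda>(x, y). gen (T x, S y)) (rep (\<Delta> a))))"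
    by (simp add: convolution_def tensor_map_def)
  then show ?thesis
    \<comment> \<open>\<open>tensor_mult\<close> picks its own representative of the image tensor;
      \<open>tensor_mult_tensor2\<close> replaces it by the explicit one.\<close>
    by (simp add: tensor_mult_tensor2[OF assoc_algebra_axioms] lin_ext_lin_ext[OF vs]
        lin_ext_gen[OF vs] sweedler_def case_prod_unfold)
qed

section \<open>The shift operators\<close>

lemma id_in_End: "id \<in> End scale"
  by (simp add: End_iff)

lemma right_shift_eq:
  "T \<in> End scale \<Longrightarrow> right_shift scale \<mu> \<Delta> T = sweedler (\<lambda>x y. \<mu> x (T y))"
  by (rule ext) (simp add: right_shift_def convolution_eq id_in_End)

lemma left_shift_eq:
  "T \<in> End scale \<Longrightarrow> left_shift scale \<mu> \<Delta> T = sweedler (\<lambda>x y. \<mu> (T x) y)"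
  by (rule ext) (simp add: left_shift_def convolution_eq id_in_End)

lemma bilinear_map_shift:
  assumes "T \<in> End scale"
  shows "bilinear_map (\<lambda>x y. \<mu> x (T y))" "bilinear_map (\<lambda>x y. \<mu> (T x) y)"
  using assms by (simp_all add: bilinear_map_def End_iff mult_simps)

lemma shift_in_End:
  assumes "T \<in> End scale"
  shows "right_shift scale \<mu> \<Delta> T \<in> End scale" "left_shift scale \<mu> \<Delta> T \<in> End scale"
  using assms by (simp_all add: right_shift_eq left_shift_eq sweedler_in_End bilinear_map_shift)

lemma End_closed:
  assumes "T \<in> End scale" "S \<in> End scale"
  shows "T \<circ> S \<in> End scale" "T + S \<in> End scale" "T - S \<in> End scale" "end_scale scale c T \<in> End scale"
  using assms by (simp_all add: End_iff end_scale_def algebra_simps)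

lemma linear_endo_on_shift:
  "linear_endo_on (end_scale scale) (End scale) (right_shift scale \<mu> \<Delta>)"
  "linear_endo_on (end_scale scale) (End scale) (left_shift scale \<mu> \<Delta>)"
  unfolding linear_endo_on_def
  by (simp_all add: shift_in_End)
    (simp_all add: right_shift_eq left_shift_eq End_closed,
      simp_all add: fun_eq_iff end_scale_def mult_simps sweedler_arith)

lemma shift_additive:
  assumes "T \<in> End scale" "S \<in> End scale"
  shows "right_shift scale \<mu> \<Delta> (T + S) = right_shift scale \<mu> \<Delta> T + right_shift scale \<mu> \<Delta> S"
    and "left_shift scale \<mu> \<Delta> (T + S) = left_shift scale \<mu> \<Delta> T + left_shift scale \<mu> \<Delta> S"
  using assms linear_endo_on_shift by (simp_all add: linear_endo_on_def)

lemma left_shift_diff: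
  assumes "T \<in> End scale" "S \<in> End scale"
  shows "left_shift scale \<mu> \<Delta> (T - S) = left_shift scale \<mu> \<Delta> T - left_shift scale \<mu> \<Delta> S"
  \<comment> \<open>Additivity is applied to \<open>(T - S) + S\<close>.\<close>
  using shift_additive(2)[OF End_closed(3)[OF assms] assms(2)] by simp

text \<open>The second equation is unapplied so that it also matches an eta-contracted
  \<open>\<lambda>v. \<mu> (sweedler f a) v\<close>.\<close>

lemma mult_sweedler:
  "\<mu> b (sweedler f a) = sweedler (\<lambda>x y. \<mu> b (f x y)) a"
  "\<mu> (sweedler f a) = (\<lambda>b. sweedler (\<lambda>x y. \<mu> (f x y) b) a)"
  using linear_image_sweedler[of "\<mu> b"] linear_image_sweedler[of "\<lambda>x. \<mu> x _"]
  by (simp_all add: End_iff mult_simps fun_eq_iff)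

text \<open>\<open>\<beta> T\<close> is linear, so it enters the sum \<open>a1 S(a2)\<close>. Of the
  three terms of the product rule, the first becomes \<open>\<beta> (T \<circ> \<beta> S)\<close>,
  the second is \<open>\<beta> (\<beta> T \<circ> S)\<close> and the subtracted one becomes
  \<open>\<beta> (\<beta> (T \<circ> S))\<close>.\<close>

lemma right_shift_nijenhuis:
  assumes T: "T \<in> End scale" and S: "S \<in> End scale"
  defines "\<beta> \<equiv> right_shift scale \<mu> \<Delta>"
  shows "(\<beta> T \<circ> \<beta> S) + \<beta> (\<beta> (T \<circ> S)) = \<beta> ((\<beta> T \<circ> S) + (T \<circ> \<beta> S))"
proof
  fix a
  note closed = T S End_closed shift_in_End
  note multilinear = trilinear_map_def bilinear_map_def End_iff mult_simps
  have \<beta>: "\<beta> R x = sweedler (\<lambda>u v. \<mu> u (R v)) x" if "R \<in> End scale" for R x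
    using that by (simp add: \<beta>_def right_shift_eq)
  have \<beta>_End: "\<beta> R \<in> End scale" if "R \<in> End scale" for R
    using that by (simp add: \<beta>_def shift_in_End)
  have expand: "\<beta> T (\<mu> u (S v)) = sweedler (\<lambda>x y. \<mu> x (T (\<mu> y (S v)))) u
      + \<mu> u (\<beta> T (S v)) - sweedler (\<lambda>x y. \<mu> x (\<mu> y (T (S v)))) u" for u v
    by (simp add: \<beta> T sweedler_mult bilinear_map_shift mult_sweedler mult_assoc)
  have "(\<beta> T \<circ> \<beta> S) a = sweedler (\<lambda>u v. \<beta> T (\<mu> u (S v))) a"
    by (simp add: \<beta>[OF S] linear_image_sweedler \<beta>_End T)
  also have "\<dots> = sweedler (\<lambda>u v. sweedler (\<lambda>x y. \<mu> x (T (\<mu> y (S v)))) u) a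
      + sweedler (\<lambda>u v. \<mu> u (\<beta> T (S v))) a
      - sweedler (\<lambda>u v. sweedler (\<lambda>x y. \<mu> x (\<mu> y (T (S v)))) u) a"
    by (simp add: expand sweedler_arith)
  \<comment> \<open>Coassociativity for the trilinear map \<open>x T(y S(z))\<close>.\<close>
  also have "sweedler (\<lambda>u v. sweedler (\<lambda>x y. \<mu> x (T (\<mu> y (S v)))) u) a =
      sweedler (\<lambda>u v. sweedler (\<lambda>x y. \<mu> u (T (\<mu> x (S y)))) v) a"
    by (rule sweedler_coassoc) (use T S in \<open>simp add: multilinear\<close>)
  also have "\<dots> = \<beta> (T \<circ> \<beta> S) a"
    by (simp add: \<beta>[OF End_closed(1)[OF T \<beta>_End[OF S]]] \<beta>[OF S]
        linear_image_sweedler[OF T] mult_sweedler)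
  also have "sweedler (\<lambda>u v. \<mu> u (\<beta> T (S v))) a = \<beta> (\<beta> T \<circ> S) a"
    by (simp add: \<beta>[OF End_closed(1)[OF \<beta>_End[OF T] S]])
  \<comment> \<open>Coassociativity for \<open>x (y T(S(z)))\<close>.\<close>
  also have "sweedler (\<lambda>u v. sweedler (\<lambda>x y. \<mu> x (\<mu> y (T (S v)))) u) a =
      sweedler (\<lambda>u v. sweedler (\<lambda>x y. \<mu> u (\<mu> x (T (S y)))) v) a"
    by (rule sweedler_coassoc) (use T S in \<open>simp add: multilinear\<close>)
  also have "\<dots> = \<beta> (\<beta> (T \<circ> S)) a"
    by (simp add: \<beta>[OF \<beta>_End[OF End_closed(1)[OF T S]]] \<beta>[OF End_closed(1)[OF T S]]
        mult_sweedler)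
  finally show "((\<beta> T \<circ> \<beta> S) + \<beta> (\<beta> (T \<circ> S))) a = \<beta> ((\<beta> T \<circ> S) + (T \<circ> \<beta> S)) a"
    unfolding \<beta>_def by (simp only: shift_additive closed) (simp add: comp_def)
qed

text \<open>The correction term of the product rule contracts the coproduct of the left factor, here
  \<open>S u\<close>, and \<open>sweedler \<mu>\<close> is \<open>\<gamma> id\<close>. So it is
  \<open>T(\<gamma> id (S u)) v\<close>, already of the form of a left shift; only the middle term
  needs coassociativity.\<close>

lemma left_shift_TD:
  assumes T: "T \<in> End scale" and S: "S \<in> End scale"
  defines "\<gamma> \<equiv> left_shift scale \<mu> \<Delta>"
  shows "\<gamma> T \<circ> \<gamma> S = \<gamma> ((\<gamma> T \<circ> S) + (T \<circ> \<gamma> S) - (T \<circ> \<gamma> id \<circ> S))"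
proof
  fix a
  note closed = T S id_in_End End_closed shift_in_End
  note multilinear = trilinear_map_def bilinear_map_def End_iff mult_simps
  have \<gamma>: "\<gamma> R x = sweedler (\<lambda>u v. \<mu> (R u) v) x" if "R \<in> End scale" for R x
    using that by (simp add: \<gamma>_def left_shift_eq)
  have \<gamma>_End: "\<gamma> R \<in> End scale" if "R \<in> End scale" for R
    using that by (simp add: \<gamma>_def shift_in_End)
  have expand: "\<gamma> T (\<mu> (S u) v) = \<mu> (\<gamma> T (S u)) v
      + sweedler (\<lambda>x y. \<mu> (T (\<mu> (S u) x)) y) v - \<mu> (T (\<gamma> id (S u))) v" for u v
    by (simp add: \<gamma> T id_in_End sweedler_mult bilinear_map_shift mult_sweedler mult_assoc)
  have "(\<gamma> T \<circ> \<gamma> S) a = sweedler (\<lambda>u v. \<gamma> T (\<mu> (S u) v)) a"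
    by (simp add: \<gamma>[OF S] linear_image_sweedler \<gamma>_End T)
  also have "\<dots> = sweedler (\<lambda>u v. \<mu> (\<gamma> T (S u)) v) a
      + sweedler (\<lambda>u v. sweedler (\<lambda>x y. \<mu> (T (\<mu> (S u) x)) y) v) a
      - sweedler (\<lambda>u v. \<mu> (T (\<gamma> id (S u))) v) a"
    by (simp add: expand sweedler_arith)
  \<comment> \<open>Coassociativity, read backwards, for \<open>T(S(x) y) z\<close>.\<close>
  also have "sweedler (\<lambda>u v. sweedler (\<lambda>x y. \<mu> (T (\<mu> (S u) x)) y) v) a =
      sweedler (\<lambda>u v. sweedler (\<lambda>x y. \<mu> (T (\<mu> (S x) y)) v) u) a"
    by (rule sweedler_coassoc[symmetric]) (use T S in \<open>simp add: multilinear\<close>)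
  also have "\<dots> = \<gamma> (T \<circ> \<gamma> S) a"
    by (simp add: \<gamma>[OF End_closed(1)[OF T \<gamma>_End[OF S]]] \<gamma>[OF S]
        linear_image_sweedler[OF T] mult_sweedler)
  also have "sweedler (\<lambda>u v. \<mu> (\<gamma> T (S u)) v) a = \<gamma> (\<gamma> T \<circ> S) a"
    by (simp add: \<gamma>[OF End_closed(1)[OF \<gamma>_End[OF T] S]])
  also have "sweedler (\<lambda>u v. \<mu> (T (\<gamma> id (S u))) v) a = \<gamma> (T \<circ> \<gamma> id \<circ> S) a"
    by (simp add: \<gamma>[OF End_closed(1)[OF End_closed(1)[OF T \<gamma>_End[OF id_in_End]] S]])
  finally show "(\<gamma> T \<circ> \<gamma> S) a = \<gamma> ((\<gamma> T \<circ> S) + (T \<circ> \<gamma> S) - (T \<circ> \<gamma> id \<circ> S)) a"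
    unfolding \<gamma>_def by (simp only: shift_additive left_shift_diff closed) (simp add: comp_def)
qed

lemma right_left_shift_commute:
  assumes T: "T \<in> End scale"
  shows "right_shift scale \<mu> \<Delta> (left_shift scale \<mu> \<Delta> T) =
    left_shift scale \<mu> \<Delta> (right_shift scale \<mu> \<Delta> T)"
proof
  fix a
  have "right_shift scale \<mu> \<Delta> (left_shift scale \<mu> \<Delta> T) a =
      sweedler (\<lambda>u v. sweedler (\<lambda>x y. \<mu> u (\<mu> (T x) y)) v) a"
    by (subst right_shift_eq[OF shift_in_End(2)[OF T]])
      (simp add: left_shift_eq[OF T] mult_sweedler)
  \<comment> \<open>Coassociativity, read backwards, for \<open>x (T(y) z)\<close>; associativity
    then regroups this as \<open>(x T(y)) z\<close>.\<close>
  also have "\<dots> = sweedler (\<lambda>u v. sweedler (\<lambda>x y. \<mu> x (\<mu> (T y) v)) u) a"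
    by (rule sweedler_coassoc[symmetric])
      (use T in \<open>simp add: trilinear_map_def bilinear_map_def End_iff mult_simps\<close>)
  also have "\<dots> = left_shift scale \<mu> \<Delta> (right_shift scale \<mu> \<Delta> T) a"
    by (subst left_shift_eq[OF shift_in_End(1)[OF T]])
      (simp add: right_shift_eq[OF T] mult_sweedler mult_assoc)
  finally show "right_shift scale \<mu> \<Delta> (left_shift scale \<mu> \<Delta> T) a =
    left_shift scale \<mu> \<Delta> (right_shift scale \<mu> \<Delta> T) a" .
qed

end

theorem proposition3p2:
  fixes scale :: "'k::field_char_0 \<Rightarrow> 'a::ab_group_add \<Rightarrow> 'a"
    and \<mu> :: "'a \<Rightarrow> 'a \<Rightarrow> 'a"
    and \<Delta> :: "'a \<Rightarrow> (('a \<times> 'a) \<Rightarrow>\<^sub>0 'k) set"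
  assumes "dendriform_nijenhuis_bialgebra scale \<mu> \<Delta>"
  shows "nijenhuis_operator (end_scale scale) (End scale) (\<circ>) (right_shift scale \<mu> \<Delta>) \<and>
    TD_operator (end_scale scale) (End scale) (\<circ>) id (left_shift scale \<mu> \<Delta>) \<and>
    (\<forall>T\<in>End scale. right_shift scale \<mu> \<Delta> (left_shift scale \<mu> \<Delta> T) =
                    left_shift scale \<mu> \<Delta> (right_shift scale \<mu> \<Delta> T))"
proof -
  interpret dendriform_nijenhuis_bialgebra scale \<mu> \<Delta> by fact
  have "assoc_algebra (end_scale scale) (End scale) (\<circ>)"
    using unital_assoc_algebra_End unital_assoc_algebra.axioms(1) by blast
  then show ?thesis
    by (simp add: nijenhuis_operator_def TD_operator_def unital_assoc_algebra_End
        linear_endo_on_shift right_shift_nijenhuis left_shift_TD right_left_shift_commute)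
qed

end
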